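(* There is a constant $\kappa_a>0$ such that for any positive real $\rho$ and any integer $x$ with $|x|\le\rho$, $$P_0\big(H(x,0)<\mathcal{E}(\rho)\big)\ \ge\ \kappa_a\Big(\frac{\rho-|x|}{\rho}\Big)^2.$$
   Context: The comb lattice $\mathcal{C}$ is the graph with vertex set $\mathbb{Z}^2$ in which $(x,y)$ and $(x',y')$ are neighbors if either $x=x'$ and $|y-y'|=1$, or $y=y'=0$ and $|x-x'|=1$. $P_0$ is the law of the simple random walk on $\mathcal{C}$ (each step goes to a uniformly chosen neighbor) started at the origin. For real $\rho$, $\mathcal{D}(\rho)=\{(x,y)\in\mathbb{Z}^2:\ |x|<\rho,\ |y|<\frac13(\rho-|x|)^2\}$. For $\Lambda\subset\mathbb{Z}^2$, $H(\Lambda)$ is the first time the walk hits $\Lambda$ (time $0$ included), $H(x,0)=H(\{(x,0)\})$, and $\mathcal{E}(\rho)=H(\mathbb{Z}^2\setminus\mathcal{D}(\rho))$ is the exit time from $\mathcal{D}(\rho)$. *)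

theory Defs
  imports "HOL-Probability.Probability" "HOL-Library.Extended_Nat"
begin

definition comb_adj :: "int \<times> int \<Rightarrow> int \<times> int \<Rightarrow> bool" where
  "comb_adj = (\<lambda>(x, y) (x', y').
     (x = x' \<and> \<bar>y - y'\<bar> = 1) \<or> (y = 0 \<and> y' = 0 \<and> \<bar>x - x'\<bar> = 1))"

definition comb_nbrs :: "int \<times> int \<Rightarrow> (int \<times> int) set" where
  "comb_nbrs v = {w. comb_adj v w}"

lemma comb_nbrs_eq:
  "comb_nbrs (x, y) =
     (if y = 0 then {(x, 1), (x, -1), (x + 1, 0), (x - 1, 0)} else {(x, y + 1), (x, y - 1)})"
  by (auto simp: comb_nbrs_def comb_adj_def)

lemma finite_comb_nbrs [simp]: "finite (comb_nbrs v)"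
  by (cases v) (simp add: comb_nbrs_eq)

lemma comb_nbrs_nonempty [simp]: "comb_nbrs v \<noteq> {}"
  by (cases v) (simp add: comb_nbrs_eq)

text \<open>Conditional law of the position at a given time, as a function of the past
  trajectory \<^term>\<open>\<omega>\<close>; at time 0 the walk sits at its starting point \<^term>\<open>v\<close>.\<close>

definition comb_kernel ::
    "int \<times> int \<Rightarrow> nat \<Rightarrow> (nat \<Rightarrow> int \<times> int) \<Rightarrow> (int \<times> int) measure" where
  "comb_kernel v i \<omega> =
     (case i of 0 \<Rightarrow> measure_pmf (return_pmf v)
      | Suc n \<Rightarrow> measure_pmf (pmf_of_set (comb_nbrs (\<omega> n))))"

interpretation comb: Ionescu_Tulcea "comb_kernel v" "\<lambda>_. count_space UNIV" for v
proof (rule Ionescu_Tulcea.intro)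
  fix i
  show "comb_kernel v i \<in> measurable (PiM {0..<i} (\<lambda>_. count_space UNIV))
          (subprob_algebra (count_space UNIV))"
  proof (cases i)
    case 0
    then show ?thesis
      by (simp add: comb_kernel_def[abs_def] measure_pmf_in_subprob_algebra)
  next
    case (Suc n)
    have "(\<lambda>w. measure_pmf (pmf_of_set (comb_nbrs w))) \<circ> (\<lambda>\<omega>. \<omega> n)
        \<in> measurable (PiM {0..<Suc n} (\<lambda>_. count_space UNIV)) (subprob_algebra (count_space UNIV))"
      by (rule measurable_comp[where N = "count_space UNIV"])
        (auto intro!: measurable_component_singleton measure_pmf_in_subprob_algebra)
    then show ?thesis
      by (simp add: comb_kernel_def[abs_def] Suc comp_def)
  qed
next
  fix i and \<omega> :: "nat \<Rightarrow> int \<times> int"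
  show "prob_space (comb_kernel v i \<omega>)"
    by (auto simp: comb_kernel_def prob_space_measure_pmf split: nat.split)
qed

text \<open>The law of the simple random walk on the comb started at \<^term>\<open>v\<close>, on the product
  sigma-algebra of the space of trajectories.\<close>

definition comb_walk :: "int \<times> int \<Rightarrow> (nat \<Rightarrow> int \<times> int) measure" where
  "comb_walk v = comb.PF.lim v"

lemma sets_comb_walk [measurable_cong]:
  "sets (comb_walk v) = sets (PiM UNIV (\<lambda>_. count_space UNIV))"
  by (simp add: comb_walk_def comb.PF.sets_lim)

lemma space_comb_walk [simp]: "space (comb_walk v) = UNIV"
  by (simp add: comb_walk_def comb.PF.space_lim space_PiM)

lemma prob_space_comb_walk: "prob_space (comb_walk v)"
proof (rule prob_space_distrD)
  show "(\<lambda>\<omega>. restrict \<omega> {}) \<in> measurable (comb_walk v) (PiM {} (\<lambda>_. count_space UNIV))"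
    by (rule measurable_restrict) simp
  show "prob_space (distr (comb_walk v) (PiM {} (\<lambda>_. count_space UNIV)) (\<lambda>\<omega>. restrict \<omega> {}))"
    unfolding comb_walk_def by (subst comb.distr_lim) (auto intro: comb.PF.prob_space_P)
qed

lemma measurable_comb_walk_component [measurable]:
  "(\<lambda>\<omega>. \<omega> n) \<in> measurable (comb_walk v) (count_space UNIV)"
  by (subst measurable_cong_sets[OF sets_comb_walk refl]) (rule measurable_component_singleton, simp)

lemma emeasure_comb_walk_cylinder_aux:
  "emeasure (comb.C v 0 n (\<lambda>_. undefined)) {restrict w {0..<n}} =
     (\<Prod>i<n. emeasure (comb_kernel v i w) {w i})"
proof (induction n)
  case 0
  have "restrict w {0..<0} = (\<lambda>_. undefined)"
    by auto
  then show ?case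
    by (simp add: space_PiM PiM_empty)
next
  case (Suc n)
  let ?M = "\<lambda>I. PiM I (\<lambda>_. count_space UNIV) :: (nat \<Rightarrow> int \<times> int) measure"
  let ?C = "comb.C v 0 n (\<lambda>_. undefined)"
  have sing: "{restrict w {0..<m}} \<in> sets (?M {0..<m})" for m
  proof -
    have "{restrict w {0..<m}} = PiE {0..<m} (\<lambda>i. {w i})"
      by (rule sym, rule PiE_singleton[of "restrict w {0..<m}" "{0..<m}", simplified, THEN trans[rotated]])
         (auto intro!: PiE_cong)
    also have "\<dots> \<in> sets (?M {0..<m})"
      by (rule sets_PiM_I_finite) auto
    finally show ?thesis .
  qed
  have sp: "space ?C = space (?M {0..<n})"
    by (subst comb.space_C) (auto simp: space_PiM)
  have sC: "sets ?C = sets (?M {0..<n})"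
    by (subst comb.sets_C) (auto simp: space_PiM)
  have "emeasure (comb.C v 0 (Suc n) (\<lambda>_. undefined)) {restrict w {0..<Suc n}} =
     (\<integral>\<^sup>+\<omega>. emeasure (comb.eP v n \<omega>) {restrict w {0..<Suc n}} \<partial>?C)"
    using comb.measurable_eP[of v n]
    by (simp, intro emeasure_bind[OF _ _ sing])
       (auto simp: sp measurable_cong_sets[OF sC refl] space_PiM)
  also have "\<dots> = (\<integral>\<^sup>+\<omega>. emeasure (comb_kernel v n w) {w n} * indicator {restrict w {0..<n}} \<omega> \<partial>?C)"
  proof (rule nn_integral_cong)
    fix \<omega> assume "\<omega> \<in> space ?C"
    then have \<omega>: "\<omega> \<in> space (?M {0..<n})" and ext: "\<omega> \<in> extensional {0..<n}"
      by (auto simp: sp space_PiM PiE_def)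
    have eq: "(\<lambda>x. fun_upd \<omega> n x) -` {restrict w {0..<Suc n}} =
        (if \<omega> = restrict w {0..<n} then {w n} else {})"
    proof -
      have "fun_upd \<omega> n x = restrict w {0..<Suc n} \<longleftrightarrow> \<omega> = restrict w {0..<n} \<and> x = w n" for x
      proof
        assume *: "fun_upd \<omega> n x = restrict w {0..<Suc n}"
        have "\<omega> i = restrict w {0..<n} i" for i
          using fun_cong[OF *, of i] ext by (cases "i < n"; cases "i = n") (auto simp: extensional_def restrict_def split: if_splits)
        moreover have "x = w n" using fun_cong[OF *, of n] by simp
        ultimately show "\<omega> = restrict w {0..<n} \<and> x = w n" by auto
      qed (auto simp: restrict_def fun_eq_iff)
      then show ?thesis unfolding vimage_def by auto
    qed
    have "comb_kernel v n (restrict w {0..<n}) = comb_kernel v n w"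
      by (auto simp: comb_kernel_def split: nat.split)
    then show "emeasure (comb.eP v n \<omega>) {restrict w {0..<Suc n}} =
        emeasure (comb_kernel v n w) {w n} * indicator {restrict w {0..<n}} \<omega>"
      by (subst comb.emeasure_eP[OF \<omega> sing]) (auto simp: eq)
  qed
  also have "\<dots> = emeasure (comb_kernel v n w) {w n} * emeasure ?C {restrict w {0..<n}}"
    by (rule nn_integral_cmult_indicator) (simp add: sC sing)
  finally show ?case
    unfolding Suc.IH by (simp only: prod.lessThan_Suc mult.commute)
qed

text \<open>The finite-dimensional distributions, confirming that \<^const>\<open>comb_walk\<close> is the
  simple random walk.\<close>

lemma emeasure_comb_walk_cylinder:
  "emeasure (comb_walk v) {\<omega>. \<forall>i\<le>n. \<omega> i = w i} =
     (if w 0 = v then \<Prod>i<n. ennreal (pmf (pmf_of_set (comb_nbrs (w i))) (w (Suc i))) else 0)"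
proof -
  let ?M = "\<lambda>I. PiM I (\<lambda>_. count_space UNIV) :: (nat \<Rightarrow> int \<times> int) measure"
  have sing_eq: "{restrict w {0..<Suc n}} = PiE {0..<Suc n} (\<lambda>i. {w i})"
    by (rule sym, rule PiE_singleton[of "restrict w {0..<Suc n}" "{0..<Suc n}", simplified, THEN trans[rotated]])
       (auto intro!: PiE_cong)
  have sing: "{restrict w {0..<Suc n}} \<in> sets (?M {0..<Suc n})"
    unfolding sing_eq by (rule sets_PiM_I_finite) auto
  have "{\<omega>. \<forall>i\<le>n. \<omega> i = w i} =
      prod_emb UNIV (\<lambda>_. count_space UNIV) {0..<Suc n} {restrict w {0..<Suc n}}"
    unfolding sing_eq by (subst prod_emb_PiE) (auto simp: PiE_iff less_Suc_eq_le Pi_iff split: if_splits)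
  then have "emeasure (comb_walk v) {\<omega>. \<forall>i\<le>n. \<omega> i = w i} =
      emeasure (comb.C v 0 (Suc n) (\<lambda>_. undefined)) {restrict w {0..<Suc n}}"
    by (simp add: comb_walk_def comb.lim[OF _ sing] comb.emeasure_CI[OF order_refl sing] prod_emb_id
        del: comb.C.simps)
  also have "\<dots> = (\<Prod>i<Suc n. emeasure (comb_kernel v i w) {w i})"
    by (rule emeasure_comb_walk_cylinder_aux)
  also have "\<dots> = (if w 0 = v then \<Prod>i<n. ennreal (pmf (pmf_of_set (comb_nbrs (w i))) (w (Suc i))) else 0)"
    by (subst prod.lessThan_Suc_shift)
       (auto simp: comb_kernel_def emeasure_pmf_single indicator_def)
  finally show ?thesis .
qed

text \<open>The infimum of the empty set is \<^term>\<open>\<infinity> :: enat\<close>: the hitting time of a set that is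
  never visited is infinite.\<close>

definition hitting_time :: "'a set \<Rightarrow> (nat \<Rightarrow> 'a) \<Rightarrow> enat" where
  "hitting_time \<Lambda> \<omega> = Inf (enat ` {n. \<omega> n \<in> \<Lambda>})"

definition comb_domain :: "real \<Rightarrow> (int \<times> int) set" where
  "comb_domain \<rho> = {(x, y). \<bar>real_of_int x\<bar> < \<rho> \<and>
     \<bar>real_of_int y\<bar> < (\<rho> - \<bar>real_of_int x\<bar>)\<^sup>2 / 3}"

definition exit_time :: "real \<Rightarrow> (nat \<Rightarrow> int \<times> int) \<Rightarrow> enat" where
  "exit_time \<rho> = hitting_time (- comb_domain \<rho>)"

lemma hitting_time_less_iff:
  "hitting_time A \<omega> < hitting_time B \<omega> \<longleftrightarrow> (\<exists>n. \<omega> n \<in> A \<and> (\<forall>m\<le>n. \<omega> m \<notin> B))"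
proof
  assume "hitting_time A \<omega> < hitting_time B \<omega>"
  then obtain n where n: "\<omega> n \<in> A" "enat n < hitting_time B \<omega>"
    by (auto simp: hitting_time_def Inf_less_iff)
  have "\<omega> m \<notin> B" if "m \<le> n" for m
  proof
    assume "\<omega> m \<in> B"
    then have "hitting_time B \<omega> \<le> enat m"
      by (auto simp: hitting_time_def intro: Inf_lower)
    also have "\<dots> \<le> enat n" using that by simp
    finally show False using n by simp
  qed
  with n show "\<exists>n. \<omega> n \<in> A \<and> (\<forall>m\<le>n. \<omega> m \<notin> B)" by blast
next
  assume "\<exists>n. \<omega> n \<in> A \<and> (\<forall>m\<le>n. \<omega> m \<notin> B)"
  then obtain n where n: "\<omega> n \<in> A" "\<forall>m\<le>n. \<omega> m \<notin> B" by blast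
  have "hitting_time A \<omega> \<le> enat n"
    using n by (auto simp: hitting_time_def intro: Inf_lower)
  also have "enat n < enat (Suc n)" by simp
  also have "enat (Suc n) \<le> hitting_time B \<omega>"
    unfolding hitting_time_def using n(2) by (intro Inf_greatest) (force simp: not_less_eq_eq[symmetric])
  finally show "hitting_time A \<omega> < hitting_time B \<omega>" .
qed

lemma sets_hitting_time_less [measurable]:
  "{\<omega>. hitting_time A \<omega> < hitting_time B \<omega>} \<in> sets (comb_walk v)"
proof -
  have "{\<omega> \<in> space (comb_walk v). \<exists>n. \<omega> n \<in> A \<and> (\<forall>m\<le>n. \<omega> m \<notin> B)} \<in> sets (comb_walk v)"
    by measurable
  then show ?thesis by (simp add: hitting_time_less_iff)
qed

end

theory Submission
  imports Defs
begin

text \<open>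
  As a function of the starting point, the probability of hitting \<open>(x, 0)\<close> before leaving the
  domain is harmonic inside the domain, except at the target, where it is \<open>1\<close>, and it vanishes
  outside. Hence it dominates every function \<open>f\<close> that is subharmonic off the target, at most \<open>1\<close>
  at the target and at most \<open>0\<close> outside (\<open>subharmonic_le_hitting_prob\<close>), and it suffices to
  exhibit such an \<open>f\<close> with a large value at the origin.

  On a tooth, harmonic functions are affine, so \<open>f\<close> is sought in the form \<open>g i\<close> on the axis,
  decreasing linearly to \<open>0\<close> at height \<open>U = (\<rho> - \<bar>i\<bar>)\<^sup>2 / 3\<close> along the tooth over \<open>i\<close>. The walk on
  the axis spends half of its steps entering teeth, and an excursion into a tooth is killed with
  probability about \<open>1 / U\<close>; subharmonicity of \<open>f\<close> thereby becomes the one-dimensional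
  inequality \<open>g (i + 1) + g (i - 1) - 2 * g i \<ge> 2 * g i / U\<close> (\<open>tent_subharmonic\<close>).

  With \<open>u = \<rho> - \<bar>i\<bar>\<close> this is a discrete version of \<open>g'' \<ge> 6 * g / u\<^sup>2\<close>, whose equality case has
  the solutions \<open>u\<^sup>3\<close> and \<open>1 / u\<^sup>2\<close>. For \<open>x \<ge> 0\<close> the profile is \<open>5 * (u / \<rho>)\<^sup>3\<close> left of the origin,
  \<open>6 * (\<rho> / u)\<^sup>2 - (u / \<rho>)\<^sup>3\<close> between the origin and \<open>x\<close>, and \<open>0\<close> beyond \<open>x\<close>. The two branches
  have the common value \<open>5\<close> at the origin, whereas the value at \<open>x\<close> is at most
  \<open>6 * (\<rho> / (\<rho> - x))\<^sup>2\<close>. After normalising the value at the target this gives the claim with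
  \<open>\<kappa> = 5 / 6\<close>, and a reflection covers \<open>x < 0\<close>.
\<close>

section \<open>Averages over the neighbors\<close>

definition comb_mean :: "(int \<times> int \<Rightarrow> real) \<Rightarrow> int \<times> int \<Rightarrow> real" where
  "comb_mean f v = (\<Sum>w\<in>comb_nbrs v. f w) / card (comb_nbrs v)"

lemma comb_mean_axis:
  "comb_mean f (i, 0) = (f (i, 1) + f (i, -1) + f (i + 1, 0) + f (i - 1, 0)) / 4"
  by (simp add: comb_mean_def comb_nbrs_eq)

lemma comb_mean_tooth:
  "y \<noteq> 0 \<Longrightarrow> comb_mean f (i, y) = (f (i, y + 1) + f (i, y - 1)) / 2"
  by (simp add: comb_mean_def comb_nbrs_eq)

lemma comb_mean_mono:
  "(\<And>w. w \<in> comb_nbrs v \<Longrightarrow> f w \<le> g w) \<Longrightarrow> comb_mean f v \<le> comb_mean g v"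
  by (simp add: comb_mean_def divide_right_mono sum_mono)

lemma comb_mean_const: "comb_mean (\<lambda>_. c) v = c"
  by (simp add: comb_mean_def)

lemma comb_mean_diff: "comb_mean (\<lambda>w. f w - g w) v = comb_mean f v - comb_mean g v"
  by (simp add: comb_mean_def sum_subtractf diff_divide_distrib)

lemma comb_mean_cmult: "comb_mean (\<lambda>w. c * f w) v = c * comb_mean f v"
  by (simp add: comb_mean_def sum_distrib_left)

section \<open>Hitting probabilities with a finite horizon\<close>

text \<open>The probability of visiting \<open>T\<close> within \<open>N\<close> steps while staying in \<open>D\<close> until then, given by
  conditioning on the first step; \<open>hit_within_le_measure\<close> is the link to the walk.\<close>

fun hit_within :: "(int \<times> int) set \<Rightarrow> (int \<times> int) set \<Rightarrow> nat \<Rightarrow> int \<times> int \<Rightarrow> real" where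
  "hit_within T D 0 v = of_bool (v \<in> T \<inter> D)"
| "hit_within T D (Suc N) v =
     (if v \<notin> D then 0 else if v \<in> T then 1 else comb_mean (hit_within T D N) v)"

lemma hit_within_bounds: "0 \<le> hit_within T D N v \<and> hit_within T D N v \<le> 1"
proof (induction N arbitrary: v)
  case (Suc N)
  have "comb_mean (\<lambda>_. 0) v \<le> comb_mean (hit_within T D N) v"
    "comb_mean (hit_within T D N) v \<le> comb_mean (\<lambda>_. 1) v"
    using Suc by (auto intro!: comb_mean_mono)
  then show ?case by (simp add: comb_mean_const)
qed simp

lemma hit_within_mono: "hit_within T D N v \<le> hit_within T D (Suc N) v"
proof (induction N arbitrary: v)
  case 0
  have "comb_mean (\<lambda>_. 0) v \<le> comb_mean (hit_within T D 0) v"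
    by (intro comb_mean_mono) simp
  then show ?case by (simp add: comb_mean_const)
next
  case (Suc N)
  have "comb_mean (hit_within T D N) v \<le> comb_mean (hit_within T D (Suc N)) v"
    by (intro comb_mean_mono Suc)
  then show ?case by simp
qed

text \<open>The Markov property: the next position is uniform on the neighbors of \<open>w n\<close>, whatever the
  earlier positions are.\<close>

lemma measure_cylinder_extend:
  assumes "u \<in> comb_nbrs (w n)"
  shows "measure (comb_walk v) {\<omega>. \<forall>i\<le>Suc n. \<omega> i = (w(Suc n := u)) i} =
     measure (comb_walk v) {\<omega>. \<forall>i\<le>n. \<omega> i = w i} / card (comb_nbrs (w n))"
proof -
  have "(\<Prod>i<n. ennreal (pmf (pmf_of_set (comb_nbrs ((w(Suc n := u)) i))) ((w(Suc n := u)) (Suc i))))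
      = (\<Prod>i<n. ennreal (pmf (pmf_of_set (comb_nbrs (w i))) (w (Suc i))))"
    by (intro prod.cong) auto
  then have "emeasure (comb_walk v) {\<omega>. \<forall>i\<le>Suc n. \<omega> i = (w(Suc n := u)) i} =
     emeasure (comb_walk v) {\<omega>. \<forall>i\<le>n. \<omega> i = w i} * ennreal (1 / card (comb_nbrs (w n)))"
    using assms unfolding emeasure_comb_walk_cylinder by simp
  then show ?thesis
    by (simp add: measure_def enn2real_mult)
qed

text \<open>A lower bound for the walk conditioned on an initial segment \<open>w\<close>. Keeping the whole segment in
  the statement, rather than only its last position, makes shifts of the trajectory unnecessary:
  the induction on \<open>N\<close> splits the event according to the next position \<open>u\<close>, and each part concerns
  a cylinder longer by one.\<close>

lemma cylinder_hit_within_le: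
  "measure (comb_walk v) {\<omega>. \<forall>i\<le>n. \<omega> i = w i} * hit_within T D N (w n) \<le>
   measure (comb_walk v) {\<omega>. (\<forall>i\<le>n. \<omega> i = w i) \<and>
     (\<exists>k\<ge>n. \<omega> k \<in> T \<and> (\<forall>m\<in>{n..k}. \<omega> m \<in> D))}"
    (is "measure ?M (?cyl n w) * _ \<le> measure ?M (?hit n w)")
proof (induction N arbitrary: n w)
  case 0
  show ?case
  proof (cases "w n \<in> T \<inter> D")
    case True
    then have "?hit n w = ?cyl n w" by force
    then show ?thesis by simp
  next
    case False
    then have "hit_within T D 0 (w n) = 0" by simp
    then show ?thesis by (simp del: hit_within.simps)
  qed
next
  case (Suc N)
  interpret prob_space ?M by (rule prob_space_comb_walk)
  have meas: "?hit n w \<in> sets ?M" for n w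
  proof -
    have "{\<omega> \<in> space ?M. (\<forall>i\<le>n. \<omega> i = w i) \<and>
       (\<exists>k\<ge>n. \<omega> k \<in> T \<and> (\<forall>m\<in>{n..k}. \<omega> m \<in> D))} \<in> sets ?M"
      by measurable
    then show ?thesis by simp
  qed
  consider "w n \<notin> D" | "w n \<in> D" "w n \<in> T" | "w n \<in> D" "w n \<notin> T" by blast
  then show ?case
  proof cases
    case 2
    then have "?hit n w = ?cyl n w" by force
    then show ?thesis using 2 by simp
  next
    case 3
    let ?B = "comb_nbrs (w n)"
    let ?ext = "\<lambda>u. w(Suc n := u)"
    have "measure ?M (?cyl n w) * hit_within T D (Suc N) (w n) =
        (\<Sum>u\<in>?B. measure ?M (?cyl n w) / card ?B * hit_within T D N u)"
      using 3 by (simp add: comb_mean_def sum_distrib_left sum_divide_distrib)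
    also have "\<dots> = (\<Sum>u\<in>?B. measure ?M (?cyl (Suc n) (?ext u)) * hit_within T D N (?ext u (Suc n)))"
      by (intro sum.cong refl) (simp only: measure_cylinder_extend fun_upd_same)
    also have "\<dots> \<le> (\<Sum>u\<in>?B. measure ?M (?hit (Suc n) (?ext u)))"
      by (intro sum_mono Suc)
    also have "\<dots> = measure ?M (\<Union>u\<in>?B. ?hit (Suc n) (?ext u))"
    proof (intro finite_measure_finite_Union[symmetric])
      show "disjoint_family_on (\<lambda>u. ?hit (Suc n) (?ext u)) ?B"
        by (auto simp: disjoint_family_on_def)
      show "(\<lambda>u. ?hit (Suc n) (?ext u)) ` ?B \<subseteq> events"
        using meas by blast
    qed simp
    also have "\<dots> \<le> measure ?M (?hit n w)"
    proof (intro finite_measure_mono meas subsetI)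
      fix \<omega> assume "\<omega> \<in> (\<Union>u\<in>?B. ?hit (Suc n) (?ext u))"
      then obtain u k where *: "\<forall>i\<le>Suc n. \<omega> i = ?ext u i" "k \<ge> Suc n" "\<omega> k \<in> T"
        "\<forall>m\<in>{Suc n..k}. \<omega> m \<in> D" by blast
      have cyl: "\<forall>i\<le>n. \<omega> i = w i"
        using *(1) by (metis fun_upd_other le_SucI not_less_eq_eq order_refl)
      moreover have "\<omega> m \<in> D" if "m \<in> {n..k}" for m
        using that *(4) cyl 3 by (cases "m = n") auto
      ultimately show "\<omega> \<in> ?hit n w"
        using *(2,3) by (auto intro!: exI[of _ k])
    qed
    finally show ?thesis .
  qed simp
qed

lemma hit_within_le_measure:
  "hit_within T D N v \<le>
     measure (comb_walk v) {\<omega>. hitting_time T \<omega> < hitting_time (- D) \<omega>}"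
proof -
  interpret prob_space "comb_walk v" by (rule prob_space_comb_walk)
  have "emeasure (comb_walk v) {\<omega>. \<forall>i\<le>0. \<omega> i = v} = 1"
    using emeasure_comb_walk_cylinder[of v 0 "\<lambda>_. v"] by simp
  then have "measure (comb_walk v) {\<omega>. \<forall>i\<le>0. \<omega> i = v} = 1"
    by (simp add: measure_def)
  then have "hit_within T D N v \<le> measure (comb_walk v)
     {\<omega>. (\<forall>i\<le>0. \<omega> i = v) \<and> (\<exists>k\<ge>0. \<omega> k \<in> T \<and> (\<forall>m\<in>{0..k}. \<omega> m \<in> D))}"
    using cylinder_hit_within_le[of v 0 "\<lambda>_. v" T D N] by simp
  also have "\<dots> \<le> measure (comb_walk v) {\<omega>. hitting_time T \<omega> < hitting_time (- D) \<omega>}"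
    by (intro finite_measure_mono sets_hitting_time_less) (auto simp: hitting_time_less_iff)
  finally show ?thesis .
qed

section \<open>Comparison with subharmonic functions\<close>

text \<open>Where a positive maximum is attained, it is attained at all neighbors. Every vertex
  \<open>(i, y)\<close> of the comb has \<open>(i, y + 1)\<close> among its neighbors, so the set of maximizers would contain
  an infinite vertical ray, although it lies in the finite set \<open>A\<close>.\<close>

lemma comb_maximum_principle:
  fixes d :: "int \<times> int \<Rightarrow> real"
  assumes fin: "finite A"
    and sub: "\<And>v. v \<in> A \<Longrightarrow> d v \<le> comb_mean d v"
    and out: "\<And>v. v \<notin> A \<Longrightarrow> d v \<le> 0"
  shows "d v \<le> 0"
proof (rule ccontr)
  assume "\<not> d v \<le> 0"
  define M where "M = Max (d ` A)"
  have vA: "v \<in> A" using out \<open>\<not> d v \<le> 0\<close> by blast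
  then have "d v \<le> M" using fin by (simp add: M_def)
  then have M: "M > 0" using \<open>\<not> d v \<le> 0\<close> by simp
  have le: "d w \<le> M" for w
    using fin M out[of w] by (cases "w \<in> A") (auto simp: M_def)
  \<comment> \<open>A mean of values at most \<open>M\<close> can reach \<open>M\<close> only if all of them equal \<open>M\<close>.\<close>
  have up: "d (i, y + 1) = M" if "d (i, y) = M" for i y
  proof -
    have "(i, y) \<in> A" using out[of "(i, y)"] M that by fastforce
    then have "M \<le> comb_mean d (i, y)" using sub that by metis
    then show ?thesis
      using le[of "(i, y + 1)"] le[of "(i, y - 1)"] le[of "(i + 1, y)"] le[of "(i - 1, y)"]
      by (cases "y = 0") (auto simp: comb_mean_axis comb_mean_tooth)
  qed
  have "M \<in> d ` A" unfolding M_def using fin vA by (intro Max_in) auto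
  then obtain i y where iy: "d (i, y) = M" by (metis image_iff surj_pair)
  have "d (i, y + int n) = M" for n
  proof (induction n)
    case (Suc n)
    then show ?case using up[of i "y + int n"] by (simp add: add.commute add.left_commute)
  qed (use iy in simp)
  then have "range (\<lambda>n. (i, y + int n)) \<subseteq> A"
    using out M by (metis image_subsetI linorder_not_le)
  moreover have "infinite (range (\<lambda>n. (i, y + int n)))"
    by (intro range_inj_infinite) (simp add: inj_on_def)
  ultimately show False using fin finite_subset by blast
qed

text \<open>The limit of the finite-horizon probabilities is harmonic on \<open>D - T\<close>, so the maximum
  principle applies to the difference of \<open>f\<close> and that limit. This takes the place of optional
  stopping, which would require the exit time to be almost surely finite.\<close>

lemma subharmonic_le_hitting_prob:
  assumes fin: "finite D"
    and sub: "\<And>v. v \<in> D \<Longrightarrow> v \<notin> T \<Longrightarrow> f v \<le> comb_mean f v"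
    and out: "\<And>v. v \<notin> D \<Longrightarrow> f v \<le> 0"
    and target: "\<And>v. v \<in> T \<Longrightarrow> v \<in> D \<Longrightarrow> f v \<le> 1"
  shows "f v \<le> measure (comb_walk v) {\<omega>. hitting_time T \<omega> < hitting_time (- D) \<omega>}"
proof -
  let ?p = "\<lambda>v. SUP N. hit_within T D N v"
  have lim: "(\<lambda>N. hit_within T D N v) \<longlonglongrightarrow> ?p v" for v
  proof (rule LIMSEQ_incseq_SUP)
    show "bdd_above (range (\<lambda>N. hit_within T D N v))"
      by (intro bdd_aboveI[of _ 1]) (auto simp del: hit_within.simps simp: hit_within_bounds)
    show "incseq (\<lambda>N. hit_within T D N v)"
      using hit_within_mono by (rule incseq_SucI)
  qed
  have "f v - ?p v \<le> 0"
  proof (rule comb_maximum_principle[of "D - T" "\<lambda>v. f v - ?p v"])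
    fix v assume v: "v \<in> D - T"
    have "(\<lambda>N. comb_mean (hit_within T D N) v) \<longlonglongrightarrow> comb_mean ?p v"
      unfolding comb_mean_def by (intro tendsto_intros lim) simp
    moreover have "(\<lambda>N. hit_within T D (Suc N) v) \<longlonglongrightarrow> ?p v"
      using lim by (rule LIMSEQ_Suc)
    ultimately have "?p v = comb_mean ?p v"
      using v LIMSEQ_unique by fastforce
    then show "f v - ?p v \<le> comb_mean (\<lambda>v. f v - ?p v) v"
      using sub[of v] v by (simp add: comb_mean_diff)
  next
    fix v assume v: "v \<notin> D - T"
    have "hit_within T D N v = of_bool (v \<in> D)" for N
      using v by (cases N) auto
    then show "f v - ?p v \<le> 0"
      using v out[of v] target[of v] by auto
  qed (use fin in simp)
  moreover have "?p v \<le> measure (comb_walk v) {\<omega>. hitting_time T \<omega> < hitting_time (- D) \<omega>}"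
    using hit_within_le_measure by (intro cSUP_least) auto
  ultimately show ?thesis by linarith
qed

section \<open>Reduction to the axis\<close>

definition tooth_height :: "real \<Rightarrow> int \<Rightarrow> real" where
  "tooth_height \<rho> i = (\<rho> - \<bar>real_of_int i\<bar>)\<^sup>2 / 3"

lemma finite_comb_domain: "finite (comb_domain \<rho>)"
proof (rule finite_subset)
  show "comb_domain \<rho> \<subseteq> {- \<lceil>\<rho>\<rceil>..\<lceil>\<rho>\<rceil>} \<times> {- \<lceil>\<rho>\<^sup>2\<rceil>..\<lceil>\<rho>\<^sup>2\<rceil>}"
  proof clarify
    fix i y assume "(i, y) \<in> comb_domain \<rho>"
    then have i: "\<bar>real_of_int i\<bar> < \<rho>" and y: "\<bar>real_of_int y\<bar> < (\<rho> - \<bar>real_of_int i\<bar>)\<^sup>2 / 3"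
      by (auto simp: comb_domain_def)
    have "(\<rho> - \<bar>real_of_int i\<bar>)\<^sup>2 \<le> \<rho>\<^sup>2" using i by (intro power_mono) auto
    then have "\<bar>real_of_int y\<bar> < \<rho>\<^sup>2" using y by linarith
    then show "i \<in> {- \<lceil>\<rho>\<rceil>..\<lceil>\<rho>\<rceil>} \<and> y \<in> {- \<lceil>\<rho>\<^sup>2\<rceil>..\<lceil>\<rho>\<^sup>2\<rceil>}"
      using i by (auto; linarith)
  qed
qed simp

definition tent :: "real \<Rightarrow> (int \<Rightarrow> real) \<Rightarrow> int \<times> int \<Rightarrow> real" where
  "tent \<rho> g = (\<lambda>(i, y). g i * max 0 (1 - \<bar>real_of_int y\<bar> / tooth_height \<rho> i))"

text \<open>On a tooth the function is the maximum of an affine function of \<open>\<bar>y\<bar>\<close> and \<open>0\<close>, hence convex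
  away from the axis. On the axis, the two neighbors in the tooth contribute at least
  \<open>2 * (g i - g i / U)\<close> to the sum over the four neighbors, and \<open>convex\<close> says precisely that the
  neighbors on the axis compensate the loss \<open>2 * g i / U\<close>.\<close>

lemma tent_subharmonic:
  assumes nonneg: "\<And>i. g i \<ge> 0"
    and convex: "\<And>i. \<bar>real_of_int i\<bar> < \<rho> \<Longrightarrow> i \<noteq> x \<Longrightarrow>
      2 * g i / tooth_height \<rho> i \<le> g (i + 1) + g (i - 1) - 2 * g i"
    and v: "v \<in> comb_domain \<rho>" "v \<noteq> (x, 0)"
  shows "tent \<rho> g v \<le> comb_mean (tent \<rho> g) v"
proof -
  obtain i y where vi: "v = (i, y)" by (cases v)
  define U where "U = tooth_height \<rho> i"
  have i: "\<bar>real_of_int i\<bar> < \<rho>" and y: "\<bar>real_of_int y\<bar> < U"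
    using v by (auto simp: vi comb_domain_def tooth_height_def U_def)
  have U: "U > 0" using y by linarith
  show ?thesis
  proof (cases "y = 0")
    case True
    have "2 * (g i / U) \<le> g (i + 1) + g (i - 1) - 2 * g i"
      using convex[OF i] v(2) True vi by (simp add: U_def)
    moreover have "g i - g i / U \<le> g i * max 0 (1 - 1 / U)"
      using mult_left_mono[OF max.cobounded2[of "1 - 1 / U" 0] nonneg[of i]]
      by (simp add: algebra_simps)
    ultimately show ?thesis
      by (simp add: vi True comb_mean_axis tent_def flip: U_def)
  next
    case False
    have "\<bar>real_of_int (y + 1)\<bar> + \<bar>real_of_int (y - 1)\<bar> = 2 * \<bar>real_of_int y\<bar>"
      using False by linarith
    then have "\<bar>real_of_int (y + 1)\<bar> / U + \<bar>real_of_int (y - 1)\<bar> / U = 2 * \<bar>real_of_int y\<bar> / U"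
      by (simp only: flip: add_divide_distrib)
    then have "2 * (1 - \<bar>real_of_int y\<bar> / U) =
        (1 - \<bar>real_of_int (y + 1)\<bar> / U) + (1 - \<bar>real_of_int (y - 1)\<bar> / U)"
      by simp
    also have "\<dots> \<le> max 0 (1 - \<bar>real_of_int (y + 1)\<bar> / U) + max 0 (1 - \<bar>real_of_int (y - 1)\<bar> / U)"
      by (intro add_mono) auto
    finally have "g i * (2 * (1 - \<bar>real_of_int y\<bar> / U)) \<le>
        g i * (max 0 (1 - \<bar>real_of_int (y + 1)\<bar> / U) + max 0 (1 - \<bar>real_of_int (y - 1)\<bar> / U))"
      by (intro mult_left_mono nonneg)
    moreover have "max 0 (1 - \<bar>real_of_int y\<bar> / U) = 1 - \<bar>real_of_int y\<bar> / U"
      using y U by simp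
    ultimately show ?thesis
      by (simp add: vi False comb_mean_tooth tent_def algebra_simps flip: U_def)
  qed
qed

section \<open>The profile on the axis\<close>

text \<open>The truncation of \<open>u - 1\<close> at \<open>0\<close> occurs at the last vertex of the axis before the left end of
  the domain; it only increases the right-hand side.\<close>

lemma cube_second_difference:
  fixes u :: real
  assumes "u > 0"
  shows "6 * u \<le> (u + 1) ^ 3 + max 0 (u - 1) ^ 3 - 2 * u ^ 3"
proof -
  have "(u - 1) ^ 3 \<le> max 0 (u - 1) ^ 3"
    by (cases "u \<ge> 1") (auto simp: max_def power_less_zero_eq less_imp_le)
  moreover have "(u + 1) ^ 3 + (u - 1) ^ 3 - 2 * u ^ 3 = 6 * u"
    by (simp add: power3_eq_cube algebra_simps)
  ultimately show ?thesis by linarith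
qed

text \<open>The second derivative of \<open>1 / u\<^sup>2\<close> is \<open>6 / u\<^sup>4\<close>, and the second difference exceeds it because
  all derivatives of even order are positive.\<close>

lemma inverse_square_second_difference:
  fixes u :: real
  assumes "u > 1"
  shows "6 / u ^ 4 \<le> 1 / (u + 1)\<^sup>2 + 1 / (u - 1)\<^sup>2 - 2 / u\<^sup>2"
proof -
  have w: "(u\<^sup>2 - 1)\<^sup>2 > 0" using assms by (simp add: power2_eq_1_iff)
  have "1 / (u + 1)\<^sup>2 + 1 / (u - 1)\<^sup>2 = 2 * (u\<^sup>2 + 1) / (u\<^sup>2 - 1)\<^sup>2"
    using assms w by (simp add: divide_simps) (simp add: power2_eq_square algebra_simps)
  moreover have "2 / u\<^sup>2 + 6 / u ^ 4 = (2 * u\<^sup>2 + 6) / u ^ 4"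
    using assms by (simp add: divide_simps power2_eq_square power4_eq_xxxx)
  moreover have "(2 * u\<^sup>2 + 6) / u ^ 4 \<le> 2 * (u\<^sup>2 + 1) / (u\<^sup>2 - 1)\<^sup>2"
  proof -
    have "2 * (u\<^sup>2 + 1) * u ^ 4 - (2 * u\<^sup>2 + 6) * (u\<^sup>2 - 1)\<^sup>2 = 2 * (5 * u\<^sup>2 - 3)"
      by (simp add: power2_eq_square power4_eq_xxxx algebra_simps)
    moreover have "u\<^sup>2 > 1" using assms by (simp add: one_less_power)
    ultimately have "0 \<le> 2 * (u\<^sup>2 + 1) * u ^ 4 - (2 * u\<^sup>2 + 6) * (u\<^sup>2 - 1)\<^sup>2" by simp
    then have "(2 * u\<^sup>2 + 6) * (u\<^sup>2 - 1)\<^sup>2 \<le> 2 * (u\<^sup>2 + 1) * u ^ 4"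
      by (simp only: diff_ge_0_iff_ge)
    then show ?thesis using assms w by (simp add: divide_simps)
  qed
  ultimately show ?thesis by linarith
qed

text \<open>The inequality for the profile at the origin, where the two branches meet, with \<open>d = 1 / \<rho>\<close>.
  For the branches \<open>a * (\<rho> / u)\<^sup>2 + b * (u / \<rho>)\<^sup>3\<close> and \<open>(a + b) * (u / \<rho>)\<^sup>3\<close>, the terms of first order
  in \<open>d\<close> have the sum \<open>- (a + 6 * b) * d\<close>, which must not be negative. The choice \<open>a = 6\<close>, \<open>b = -1\<close>
  makes the profile differentiable in the limit; the terms of second order then agree as well, and
  the inequality is decided at third order. This is why the expansion of \<open>1 / (1 - d)\<^sup>2\<close> is taken up
  to \<open>4 * d\<^sup>3\<close>.\<close>

lemma kink_inequality:
  fixes d :: real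
  assumes "0 < d" "d < 1"
  shows "10 + 30 * d\<^sup>2 \<le> 6 / (1 - d)\<^sup>2 + 4 * (1 - d) ^ 3"
proof -
  have "(1 + 2 * d + 3 * d\<^sup>2 + 4 * d ^ 3) * (1 - d)\<^sup>2 = 1 - d ^ 4 * (5 - 4 * d)"
    by (simp add: power2_eq_square power3_eq_cube power4_eq_xxxx algebra_simps)
  moreover have "d ^ 4 * (5 - 4 * d) \<ge> 0"
    using assms by simp
  ultimately have "1 + 2 * d + 3 * d\<^sup>2 + 4 * d ^ 3 \<le> 1 / (1 - d)\<^sup>2"
    using assms by (simp add: pos_le_divide_eq)
  moreover have "4 * (1 - d) ^ 3 = 4 - 12 * d + 12 * d\<^sup>2 - 4 * d ^ 3"
    by (simp add: power2_eq_square power3_eq_cube algebra_simps)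
  moreover have "d ^ 3 \<ge> 0" using assms by simp
  \<comment> \<open>The powers are abstracted so that the inequality becomes linear.\<close>
  moreover define p q t where "p = 1 / (1 - d)\<^sup>2" and "q = (1 - d) ^ 3" and "t = d ^ 3"
  ultimately have "10 + 30 * d\<^sup>2 \<le> 6 * p + 4 * q"
    unfolding p_def[symmetric] q_def[symmetric] t_def[symmetric] by linarith
  then show ?thesis by (simp add: p_def q_def)
qed

text \<open>The formulas are in terms of \<open>\<rho> - \<bar>i\<bar>\<close>, for \<open>x \<ge> 0\<close>. Setting the profile to \<open>0\<close> beyond the
  target is harmless: the inequality is trivial where the profile vanishes, and it is not required
  at \<open>x\<close> itself.\<close>

definition axis_profile :: "real \<Rightarrow> int \<Rightarrow> int \<Rightarrow> real" where
  "axis_profile \<rho> x i =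
     (if i > x then 0
      else if i \<ge> 0 then 6 * (\<rho> / (\<rho> - i))\<^sup>2 - ((\<rho> - i) / \<rho>) ^ 3
      else 5 * (max 0 (\<rho> + i) / \<rho>) ^ 3)"

context
  fixes \<rho> :: real and x :: int
  assumes x: "0 \<le> x" "real_of_int x < \<rho>"
begin

lemma axis_profile_nonneg: "axis_profile \<rho> x i \<ge> 0"
proof (cases "0 \<le> i \<and> i \<le> x")
  case True
  then have i: "real_of_int i \<ge> 0" "real_of_int i < \<rho>" using x by linarith+
  have "1 \<le> (\<rho> / (\<rho> - i))\<^sup>2" using i by (simp add: one_le_power)
  moreover have "((\<rho> - i) / \<rho>) ^ 3 \<le> 1" using i by (intro power_le_one) auto
  ultimately show ?thesis using True by (simp add: axis_profile_def)
qed (use x in \<open>auto simp: axis_profile_def\<close>)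

lemma axis_profile_outside:
  assumes "\<bar>real_of_int i\<bar> \<ge> \<rho>"
  shows "axis_profile \<rho> x i = 0"
proof (cases "i \<ge> 0")
  case True
  then have "i > x" using assms x by linarith
  then show ?thesis by (simp add: axis_profile_def)
next
  case False
  then have "real_of_int i \<le> - \<rho>" using assms by linarith
  then show ?thesis using False x by (auto simp: axis_profile_def)
qed

lemma axis_profile_convex:
  assumes i: "\<bar>real_of_int i\<bar> < \<rho>" "i \<noteq> x"
  shows "2 * axis_profile \<rho> x i / tooth_height \<rho> i \<le>
    axis_profile \<rho> x (i + 1) + axis_profile \<rho> x (i - 1) - 2 * axis_profile \<rho> x i"
proof -
  let ?g = "axis_profile \<rho> x"
  have \<rho>: "\<rho> > 0" using i by linarith
  define u where "u = \<rho> - \<bar>real_of_int i\<bar>"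
  have u: "u > 0" using i by (simp add: u_def)
  have lhs: "2 * a / tooth_height \<rho> i = 6 * a / u\<^sup>2" for a
    by (simp add: tooth_height_def u_def)
  consider "i > x" | "0 < i" "i < x" | "i = 0" "0 < x" | "i < 0"
    using i by linarith
  then show ?thesis
  proof cases
    case 1
    then show ?thesis using axis_profile_nonneg[of "i - 1"] by (simp add: axis_profile_def)
  next
    case 2
    have "u > 1" using 2 x by (simp add: u_def)
    have g: "?g i = 6 * \<rho>\<^sup>2 * (1 / u\<^sup>2) - u ^ 3 / \<rho> ^ 3"
      "?g (i + 1) = 6 * \<rho>\<^sup>2 * (1 / (u - 1)\<^sup>2) - (u - 1) ^ 3 / \<rho> ^ 3"
      "?g (i - 1) = 6 * \<rho>\<^sup>2 * (1 / (u + 1)\<^sup>2) - (u + 1) ^ 3 / \<rho> ^ 3"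
      using 2 by (auto simp: axis_profile_def u_def power_divide algebra_simps)
    have "6 * ?g i / u\<^sup>2 = 6 * \<rho>\<^sup>2 * (6 / u ^ 4) - 6 * u / \<rho> ^ 3"
      using u \<rho> unfolding g by (simp add: field_simps power2_eq_square power3_eq_cube power4_eq_xxxx)
    also have "\<dots> \<le> 6 * \<rho>\<^sup>2 * (1 / (u + 1)\<^sup>2 + 1 / (u - 1)\<^sup>2 - 2 / u\<^sup>2) - 6 * u / \<rho> ^ 3"
      using inverse_square_second_difference[OF \<open>u > 1\<close>] by (intro diff_right_mono mult_left_mono) auto
    also have "6 * u = (u + 1) ^ 3 + (u - 1) ^ 3 - 2 * u ^ 3"
      by (simp add: power3_eq_cube algebra_simps)
    finally show ?thesis
      unfolding lhs g by (simp add: algebra_simps add_divide_distrib diff_divide_distrib)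
  next
    case 3
    define d where "d = 1 / \<rho>"
    have "\<rho> > 1" using 3 x by linarith
    then have d: "0 < d" "d < 1" by (auto simp: d_def)
    have "(\<rho> - 1) / \<rho> = 1 - d" "\<rho> / (\<rho> - 1) = 1 / (1 - d)"
      using \<open>\<rho> > 1\<close> by (auto simp: d_def field_simps)
    then have "?g 0 = 5" "?g 1 = 6 / (1 - d)\<^sup>2 - (1 - d) ^ 3" "?g (-1) = 5 * (1 - d) ^ 3"
      using 3 \<open>\<rho> > 1\<close> by (auto simp: axis_profile_def power_divide)
    moreover have "6 / u\<^sup>2 = 6 * d\<^sup>2"
      using 3 by (simp add: u_def d_def power_divide)
    ultimately show ?thesis
      using kink_inequality[OF d] 3 unfolding lhs by simp
  next
    case 4
    have g: "?g i = 5 / \<rho> ^ 3 * u ^ 3" "?g (i + 1) = 5 / \<rho> ^ 3 * (u + 1) ^ 3"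
        "?g (i - 1) = 5 / \<rho> ^ 3 * max 0 (u - 1) ^ 3"
    proof -
      show "?g i = 5 / \<rho> ^ 3 * u ^ 3"
        using 4 x u by (simp add: axis_profile_def u_def power_divide)
      show "?g (i - 1) = 5 / \<rho> ^ 3 * max 0 (u - 1) ^ 3"
        using 4 x by (simp add: axis_profile_def u_def power_divide algebra_simps)
      show "?g (i + 1) = 5 / \<rho> ^ 3 * (u + 1) ^ 3"
        \<comment> \<open>The right neighbor of \<open>-1\<close> is the origin, whose value is given by the other branch.\<close>
      proof (cases "i = -1")
        case True
        then show ?thesis using x \<rho> by (simp add: axis_profile_def u_def)
      next
        case False
        then show ?thesis using 4 x u by (simp add: axis_profile_def u_def power_divide algebra_simps)
      qed
    qed
    have "6 * ?g i / u\<^sup>2 = 5 / \<rho> ^ 3 * (6 * u)"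
      using u unfolding g by (simp add: power2_eq_square power3_eq_cube)
    also have "\<dots> \<le> 5 / \<rho> ^ 3 * ((u + 1) ^ 3 + max 0 (u - 1) ^ 3 - 2 * u ^ 3)"
      using cube_second_difference[OF u] \<rho> by (intro mult_left_mono) auto
    finally show ?thesis unfolding lhs g by (simp add: algebra_simps)
  qed
qed

end

text \<open>The conditions on the profile are invariant under \<open>i \<mapsto> - i\<close>, which reduces negative \<open>x\<close> to
  positive ones.\<close>

lemma exists_axis_profile:
  fixes \<rho> :: real and x :: int
  assumes x: "\<bar>real_of_int x\<bar> < \<rho>"
  obtains g :: "int \<Rightarrow> real" where "\<And>i. g i \<ge> 0"
    and "\<And>i. \<bar>real_of_int i\<bar> \<ge> \<rho> \<Longrightarrow> g i = 0"
    and "\<And>i. \<bar>real_of_int i\<bar> < \<rho> \<Longrightarrow> i \<noteq> x \<Longrightarrow>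
      2 * g i / tooth_height \<rho> i \<le> g (i + 1) + g (i - 1) - 2 * g i"
    and "g 0 = 5" and "g x \<le> 6 * (\<rho> / (\<rho> - \<bar>x\<bar>))\<^sup>2"
proof -
  define \<sigma> :: int where "\<sigma> = (if x \<ge> 0 then 1 else -1)"
  define g where "g i = axis_profile \<rho> \<bar>x\<bar> (\<sigma> * i)" for i
  have x': "0 \<le> \<bar>x\<bar>" "real_of_int \<bar>x\<bar> < \<rho>" using x by auto
  have \<sigma>: "\<sigma> = 1 \<or> \<sigma> = -1" "\<sigma> * x = \<bar>x\<bar>" by (auto simp: \<sigma>_def)
  have abs: "\<bar>real_of_int (\<sigma> * i)\<bar> = \<bar>real_of_int i\<bar>" for i using \<sigma>(1) by auto
  show ?thesis
  proof (rule that)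
    show "g i \<ge> 0" for i unfolding g_def by (rule axis_profile_nonneg[OF x'])
    show "g i = 0" if "\<bar>real_of_int i\<bar> \<ge> \<rho>" for i
      unfolding g_def using that by (intro axis_profile_outside[OF x']) (simp only: abs)
    show "2 * g i / tooth_height \<rho> i \<le> g (i + 1) + g (i - 1) - 2 * g i"
      if i: "\<bar>real_of_int i\<bar> < \<rho>" "i \<noteq> x" for i
    proof -
      have "\<sigma> * i \<noteq> \<bar>x\<bar>" using \<sigma> i(2) by auto
      moreover have "\<bar>real_of_int (\<sigma> * i)\<bar> < \<rho>" using i(1) by (simp only: abs)
      ultimately have "2 * g i / tooth_height \<rho> (\<sigma> * i) \<le>
          axis_profile \<rho> \<bar>x\<bar> (\<sigma> * i + 1) + axis_profile \<rho> \<bar>x\<bar> (\<sigma> * i - 1) - 2 * g i"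
        unfolding g_def by (intro axis_profile_convex[OF x'])
      moreover have "tooth_height \<rho> (\<sigma> * i) = tooth_height \<rho> i"
        unfolding tooth_height_def abs ..
      moreover have "axis_profile \<rho> \<bar>x\<bar> (\<sigma> * i + 1) + axis_profile \<rho> \<bar>x\<bar> (\<sigma> * i - 1) =
          g (i + 1) + g (i - 1)"
        using \<sigma>(1) by (auto simp: g_def distrib_left right_diff_distrib minus_diff_commute)
      ultimately show ?thesis by simp
    qed
    show "g 0 = 5" using x by (simp add: g_def axis_profile_def)
    show "g x \<le> 6 * (\<rho> / (\<rho> - \<bar>x\<bar>))\<^sup>2"
      using x by (simp add: g_def \<sigma>(2) axis_profile_def)
  qed
qed

section \<open>The lower bound for the hitting probability\<close>

theorem proposition2p2:
  shows "\<exists>\<kappa>::real. \<kappa> > 0 \<and>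
    (\<forall>(\<rho>::real) (x::int). \<rho> > 0 \<longrightarrow> \<bar>real_of_int x\<bar> \<le> \<rho> \<longrightarrow>
       measure (comb_walk (0, 0)) {\<omega>. hitting_time {(x, 0)} \<omega> < exit_time \<rho> \<omega>}
         \<ge> \<kappa> * ((\<rho> - \<bar>real_of_int x\<bar>) / \<rho>)\<^sup>2)"
proof (intro exI[of _ "5 / 6"] conjI allI impI)
  fix \<rho> :: real and x :: int
  assume \<rho>: "\<rho> > 0" and "\<bar>real_of_int x\<bar> \<le> \<rho>"
  then consider "\<bar>real_of_int x\<bar> = \<rho>" | "\<bar>real_of_int x\<bar> < \<rho>" by linarith
  then show "5 / 6 * ((\<rho> - \<bar>real_of_int x\<bar>) / \<rho>)\<^sup>2 \<le>
    measure (comb_walk (0, 0)) {\<omega>. hitting_time {(x, 0)} \<omega> < exit_time \<rho> \<omega>}"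
  proof cases
    case 2
    obtain g :: "int \<Rightarrow> real" where nonneg: "\<And>i. g i \<ge> 0"
      and zero: "\<And>i. \<bar>real_of_int i\<bar> \<ge> \<rho> \<Longrightarrow> g i = 0"
      and convex: "\<And>i. \<bar>real_of_int i\<bar> < \<rho> \<Longrightarrow> i \<noteq> x \<Longrightarrow>
        2 * g i / tooth_height \<rho> i \<le> g (i + 1) + g (i - 1) - 2 * g i"
      and g0: "g 0 = 5" and gx: "g x \<le> 6 * (\<rho> / (\<rho> - \<bar>x\<bar>))\<^sup>2"
      using exists_axis_profile[OF 2] by metis
    \<comment> \<open>The factor that brings the value at the target down to at most \<open>1\<close>.\<close>
    define c where "c = ((\<rho> - \<bar>real_of_int x\<bar>) / \<rho>)\<^sup>2 / 6"
    have c: "c > 0" using 2 \<rho> by (simp add: c_def)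
    have "c * tent \<rho> g (0, 0) \<le> measure (comb_walk (0, 0))
        {\<omega>. hitting_time {(x, 0)} \<omega> < hitting_time (- comb_domain \<rho>) \<omega>}"
    proof (rule subharmonic_le_hitting_prob)
      show "finite (comb_domain \<rho>)" by (rule finite_comb_domain)
      show "c * tent \<rho> g v \<le> comb_mean (\<lambda>v. c * tent \<rho> g v) v"
        if "v \<in> comb_domain \<rho>" "v \<notin> {(x, 0)}" for v
        using tent_subharmonic[OF nonneg convex that(1)] that(2) c
        by (simp add: comb_mean_cmult mult_left_mono)
      show "c * tent \<rho> g v \<le> 0" if "v \<notin> comb_domain \<rho>" for v
      proof -
        obtain i y where v: "v = (i, y)" by (cases v)
        have "tent \<rho> g v = 0"
        proof (cases "\<bar>real_of_int i\<bar> < \<rho>")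
          case True
          then have "tooth_height \<rho> i > 0" "tooth_height \<rho> i \<le> \<bar>real_of_int y\<bar>"
            using that by (auto simp: v comb_domain_def tooth_height_def)
          then show ?thesis by (simp add: v tent_def)
        qed (simp add: v tent_def zero)
        then show ?thesis by simp
      qed
      show "c * tent \<rho> g v \<le> 1" if "v \<in> {(x, 0)}" for v
      proof -
        have "c * tent \<rho> g v = c * g x" using that by (simp add: tent_def)
        also have "\<dots> \<le> c * (6 * (\<rho> / (\<rho> - \<bar>x\<bar>))\<^sup>2)"
          using gx c by (intro mult_left_mono) auto
        also have "\<dots> = 1" using 2 \<rho> by (simp add: c_def power_divide)
        finally show ?thesis .
      qed
    qed
    then show ?thesis by (simp add: exit_time_def c_def tent_def g0)
  qed simp
qed simp

end
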